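(* Let $n\in\mathbb{Z}_+$, $n-1<\alpha<n$, $a\in\mathbb{R}$, and $\lambda\in\mathbb{R}$ with $\lambda\neq 1$. Consider the discrete fractional order system $${}_a\nabla_k^{\alpha}y(k)=\lambda y(k)+u(k),\qquad k\in\mathbb{N}_{a+1},$$ with $y(k)\in\mathbb{R}$, $u(k)\in\mathbb{R}$, and initial conditions $$\nabla^{\kappa}y(k)\big|_{k=a}=b_\kappa,\qquad \kappa=0,1,\dots,n-1,$$ where $b_0,\dots,b_{n-1}\in\mathbb{R}$. Then the time-domain response $y$ of this system is unique and is given, for $k\in\mathbb{N}_{a+1}$, by $$y(k)=\sum_{\kappa=0}^{n-1}b_\kappa\,\mathcal{F}_{\alpha,\kappa+1}(\lambda,k,a)+\sum_{\tau=a+1}^{k}\mathcal{F}_{\alpha,\alpha}(\lambda,\tau,a)\,u(k-\tau+a+1).$$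
   Context: Notation: $\mathbb{N}_{c}=\{c,c+1,c+2,\dots\}$. $\Gamma$ is the Gamma function, and $\binom{p}{q}=\frac{\Gamma(p+1)}{\Gamma(q+1)\Gamma(p-q+1)}$, so that for $j\in\mathbb{N}$, $\binom{p}{j}=\frac{p(p-1)\cdots(p-j+1)}{j!}$. Backward difference: $\nabla^n f(k)=\sum_{j=0}^{n}(-1)^j\binom{n}{j}f(k-j)$, with $\nabla^0 f=f$. Nabla fractional sum: for $\gamma>0$, $f:\mathbb{N}_{a+1}\to\mathbb{R}$ and $k\in\mathbb{N}_{a+1}$, ${}_a\nabla_k^{-\gamma}f(k)=\sum_{j=0}^{k-a-1}(-1)^j\binom{-\gamma}{j}f(k-j)$. Nabla Caputo fractional difference: for $n-1<\alpha<n$, $n\in\mathbb{Z}_+$, and $f:\mathbb{N}_{a-n}\to\mathbb{R}$, ${}_a\nabla_k^{\alpha}f(k)={}_a\nabla_k^{\alpha-n}\,\nabla^n f(k)$, i.e. the nabla fractional sum of order $n-\alpha$ of the function $\nabla^n f$. Rising function: $p^{\overline{q}}=\frac{\Gamma(p+q)}{\Gamma(p)}$. Discrete Mittag-Leffler function: $\mathcal{F}_{\alpha,\beta}(\lambda,k,a)=\sum_{j=0}^{+\infty}\frac{\lambda^j}{\Gamma(j\alpha+\beta)}(k-a)^{\overline{j\alpha+\beta-1}}$. The "time-domain response" is a real function $y$ satisfying the system equation and the initial conditions.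
   Formalization: The series defining the discrete Mittag-Leffler function diverges for |λ| ≥ 1 (at k = a+1 it is Σ λ^j); for such λ ≠ 1 its value is taken to be the analytic continuation in λ to the complex plane without 1, and for |λ| < 1 it is the series itself. *)

theory Defs
  imports "HOL-Complex_Analysis.Complex_Analysis"
begin

text \<open>
  The time axis is \<open>a + \<int>\<close> for a real \<open>a\<close>, so signals are total functions on the reals
  of which only the values on the relevant set \<open>nset c\<close> are ever used.
\<close>

definition nset :: "real \<Rightarrow> real set" where
  "nset c = {c + real j | j::nat. True}"

definition nabla_diff :: "nat \<Rightarrow> (real \<Rightarrow> real) \<Rightarrow> real \<Rightarrow> real" where
  "nabla_diff n f k = (\<Sum>j=0..n. (-1) ^ j * real (n choose j) * f (k - real j))"

definition nabla_frac_sum :: "real \<Rightarrow> real \<Rightarrow> (real \<Rightarrow> real) \<Rightarrow> real \<Rightarrow> real" where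
  "nabla_frac_sum a \<gamma> f k =
     (\<Sum>j | real j \<le> k - a - 1. (-1) ^ j * ((- \<gamma>) gchoose j) * f (k - real j))"

text \<open>Meaningful for \<open>n - 1 < \<alpha> < n\<close>.\<close>

definition nabla_caputo :: "nat \<Rightarrow> real \<Rightarrow> real \<Rightarrow> (real \<Rightarrow> real) \<Rightarrow> real \<Rightarrow> real" where
  "nabla_caputo n \<alpha> a f k = nabla_frac_sum a (real n - \<alpha>) (nabla_diff n f) k"

definition rising :: "real \<Rightarrow> real \<Rightarrow> real" where
  "rising p q = Gamma (p + q) / Gamma p"

definition ml_coeff :: "real \<Rightarrow> real \<Rightarrow> real \<Rightarrow> real \<Rightarrow> nat \<Rightarrow> real" where
  "ml_coeff \<alpha> \<beta> k a j =
     rising (k - a) (real j * \<alpha> + \<beta> - 1) / Gamma (real j * \<alpha> + \<beta>)"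

text \<open>
  For \<open>k \<in> nset (a + 1)\<close> the coefficients are a polynomial in \<open>j\<close>, so the power series in
  \<open>lam\<close> converges exactly for \<open>\<bar>lam\<bar> < 1\<close>, and its sum is a rational function whose only pole
  is \<open>1\<close>. Where the series converges, the discrete Mittag-Leffler function is its sum; at the
  other points \<open>lam \<noteq> 1\<close> it is the value of the analytic continuation of that sum to the
  complex plane without \<open>1\<close>. The continuation is taken through the complex plane because
  the reals without \<open>1\<close> are disconnected.
\<close>

definition disc_ml :: "real \<Rightarrow> real \<Rightarrow> real \<Rightarrow> real \<Rightarrow> real \<Rightarrow> real" where
  "disc_ml \<alpha> \<beta> lam k a =
     (if summable (\<lambda>j. lam ^ j / Gamma (real j * \<alpha> + \<beta>) * rising (k - a) (real j * \<alpha> + \<beta> - 1))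
      then (\<Sum>j. lam ^ j / Gamma (real j * \<alpha> + \<beta>) * rising (k - a) (real j * \<alpha> + \<beta> - 1))
      else (THE w. \<exists>g. g holomorphic_on (- {1}) \<and>
              (\<forall>z\<in>ball 0 1. (\<lambda>j. complex_of_real (ml_coeff \<alpha> \<beta> k a j) * z ^ j) sums g z) \<and>
              g (complex_of_real lam) = complex_of_real w))"

definition time_response ::
  "nat \<Rightarrow> real \<Rightarrow> real \<Rightarrow> real \<Rightarrow> (real \<Rightarrow> real) \<Rightarrow> (nat \<Rightarrow> real) \<Rightarrow> (real \<Rightarrow> real) \<Rightarrow> bool" where
  "time_response n \<alpha> a lam u b y \<longleftrightarrow>
     (\<forall>k \<in> nset (a + 1). nabla_caputo n \<alpha> a y k = lam * y k + u k) \<and>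
     (\<forall>\<kappa><n. nabla_diff \<kappa> y a = b \<kappa>)"

end

theory Submission imports Defs begin

text \<open>
  The idea is to encode a signal on \<open>{a + 1, a + 2, \<dots>}\<close> by its generating function
  \<open>\<Sum>\<^sub>m f (a + 1 + m) X\<^sup>m\<close>. The fractional sum of order \<open>\<gamma>\<close> is a convolution with the
  coefficients of \<open>(1 - X) powr (- \<gamma>)\<close>, and \<open>\<nabla>\<close> is multiplication by \<open>1 - X\<close> up to the
  boundary value at \<open>a\<close>. Hence the Caputo difference of \<open>y\<close> has generating function
  \<open>(1 - X) powr \<alpha> * Y - \<Sum>\<^sub>\<kappa> b\<^sub>\<kappa> * (1 - X) powr (\<alpha> - \<kappa> - 1)\<close>, and under the initial
  conditions the system is the single linear equation
  \<open>((1 - X) powr \<alpha> - lam) * Y = U + \<Sum>\<^sub>\<kappa> b\<^sub>\<kappa> * (1 - X) powr (\<alpha> - \<kappa> - 1)\<close>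
  between formal power series. The factor on the left has constant term \<open>1 - lam\<close>, so for
  \<open>lam \<noteq> 1\<close> it can be inverted, which gives existence and uniqueness on \<open>{a + 1, \<dots>}\<close>
  (lemma \<open>time_response_iff_signal_fps\<close>). The initial conditions are a triangular linear
  system with diagonal entries \<open>\<plusminus>1\<close> for the values \<open>y (a - \<kappa>)\<close> with \<open>\<kappa> < n\<close>.

  The solution formula then says that the discrete Mittag-Leffler functions are the
  coefficients of the quotient \<open>(1 - X) powr (\<alpha> - \<beta>) / ((1 - X) powr \<alpha> - lam)\<close>
  (lemma \<open>disc_ml_eq_ml_fps_nth\<close>). Expanding the quotient as the geometric series
  \<open>\<Sum>\<^sub>j lam\<^sup>j * (1 - X) powr (- (j * \<alpha> + \<beta>))\<close> gives exactly the defining series when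
  \<open>\<bar>lam\<bar> < 1\<close>. For other \<open>lam\<close> that series diverges, but every coefficient of the quotient
  is a rational function of \<open>lam\<close> without poles other than \<open>1\<close>; by the identity theorem it is
  the analytic continuation that defines the function there.
\<close>

unbundle no vec_syntax
unbundle fps_syntax

section \<open>Real powers of \<open>1 - X\<close>\<close>

text \<open>
  The binomial series of \<open>(1 - X) powr c\<close>. Its coefficients are the weights of the fractional
  sum for \<open>c = - \<gamma>\<close> and of the backward difference for \<open>c = n\<close>.
\<close>

definition one_minus_X_powr :: "'a::field_char_0 \<Rightarrow> 'a fps" where
  "one_minus_X_powr c = Abs_fps (\<lambda>j. (-1) ^ j * (c gchoose j))"

lemma one_minus_X_powr_nth_0 [simp]: "one_minus_X_powr c $ 0 = 1"
  by (simp add: one_minus_X_powr_def)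

lemma one_minus_X_powr_nth_pochhammer:
  "one_minus_X_powr c $ j = pochhammer (- c) j / fact j"
  by (simp add: one_minus_X_powr_def gbinomial_pochhammer flip: power_mult_distrib mult.assoc)

text \<open>The exponent law is Vandermonde's convolution of generalised binomial coefficients.\<close>

lemma one_minus_X_powr_add:
  "one_minus_X_powr (c + d) = one_minus_X_powr c * one_minus_X_powr d"
proof (rule fps_ext)
  fix n
  have "(\<Sum>i=0..n. (-1) ^ i * (c gchoose i) * ((-1) ^ (n - i) * (d gchoose (n - i)))) =
        (\<Sum>i=0..n. (-1) ^ n * ((c gchoose i) * (d gchoose (n - i))))"
  proof (rule sum.cong)
    fix i assume "i \<in> {0..n}"
    then have "(-1::'a) ^ i * (-1) ^ (n - i) = (-1) ^ n"
      by (simp flip: power_add)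
    then show "(-1) ^ i * (c gchoose i) * ((-1) ^ (n - i) * (d gchoose (n - i))) =
               (-1) ^ n * ((c gchoose i) * (d gchoose (n - i)))"
      by (metis (no_types, lifting) mult.assoc mult.left_commute)
  qed simp
  then show "one_minus_X_powr (c + d) $ n = (one_minus_X_powr c * one_minus_X_powr d) $ n"
    by (simp add: one_minus_X_powr_def fps_mult_nth flip: sum_distrib_left gbinomial_Vandermonde)
qed

lemma one_minus_X_powr_0: "one_minus_X_powr 0 = 1"
  by (rule fps_ext) (simp add: one_minus_X_powr_def gbinomial_0_left)

lemma one_minus_X_powr_1: "one_minus_X_powr 1 = 1 - fps_X"
proof (rule fps_ext)
  fix n
  have "(1::'a) gchoose n = of_nat (1 choose n)"
    using binomial_gbinomial[of 1 n, where 'a='a] by simp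
  then show "one_minus_X_powr 1 $ n = (1 - fps_X :: 'a fps) $ n"
    by (cases n; cases "n - 1") (auto simp: one_minus_X_powr_def)
qed

lemma one_minus_X_powr_of_real:
  "one_minus_X_powr (of_real c :: 'a::real_field) $ n = of_real (one_minus_X_powr c $ n)"
  by (simp add: one_minus_X_powr_nth_pochhammer flip: pochhammer_of_real)

section \<open>The generating function of the discrete Mittag-Leffler functions\<close>

text \<open>
  The quotient \<open>(1 - X) powr (\<alpha> - \<beta>) / ((1 - X) powr \<alpha> - z)\<close>. It is generic in the field
  because the system needs it over the reals and the analytic continuation in \<open>z\<close> over the
  complex numbers.
\<close>

definition ml_fps :: "'a::field_char_0 \<Rightarrow> 'a \<Rightarrow> 'a \<Rightarrow> 'a fps" where
  "ml_fps \<alpha> \<beta> z = one_minus_X_powr (\<alpha> - \<beta>) * inverse (one_minus_X_powr \<alpha> - fps_const z)"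

lemma ml_fps_mult:
  assumes "z \<noteq> 1"
  shows "(one_minus_X_powr \<alpha> - fps_const z) * ml_fps \<alpha> \<beta> z = one_minus_X_powr (\<alpha> - \<beta>)"
proof -
  have "inverse (one_minus_X_powr \<alpha> - fps_const z) * (one_minus_X_powr \<alpha> - fps_const z) = 1"
    using assms by (intro inverse_mult_eq_1) simp
  then show ?thesis
    by (simp add: ml_fps_def mult_ac)
qed

lemma ml_fps_unique:
  assumes "z \<noteq> 1" and "(one_minus_X_powr \<alpha> - fps_const z) * S = one_minus_X_powr (\<alpha> - \<beta>)"
  shows "S = ml_fps \<alpha> \<beta> z"
proof -
  have "(one_minus_X_powr \<alpha> - fps_const z) $ 0 \<noteq> 0"
    using assms by simp
  then have "one_minus_X_powr \<alpha> - fps_const z \<noteq> 0"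
    by (metis fps_zero_nth)
  moreover have "(one_minus_X_powr \<alpha> - fps_const z) * S = 
    (one_minus_X_powr \<alpha> - fps_const z) * ml_fps \<alpha> \<beta> z"
    using assms ml_fps_mult by metis
  ultimately show ?thesis
    by simp
qed

text \<open>
  The images of the coefficients of the real quotient solve the equation that defines the
  quotient over the larger field, and that equation has only one solution.
\<close>

lemma ml_fps_of_real:
  assumes "lam \<noteq> 1"
  shows "ml_fps (of_real \<alpha>) (of_real \<beta>) (of_real lam :: 'a::real_field) $ m =
         of_real (ml_fps \<alpha> \<beta> lam $ m)"
proof -
  let ?S = "Abs_fps (\<lambda>m. of_real (ml_fps \<alpha> \<beta> lam $ m) :: 'a)"
  have 1: "(one_minus_X_powr (of_real \<alpha>) - fps_const (of_real lam :: 'a)) $ i =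
     of_real ((one_minus_X_powr \<alpha> - fps_const lam) $ i)" for i
    by (simp add: one_minus_X_powr_of_real)
  have "(one_minus_X_powr (of_real \<alpha>) - fps_const (of_real lam)) * ?S =
        one_minus_X_powr (of_real \<alpha> - of_real \<beta>)"
  proof (rule fps_ext)
    fix n
    have "((one_minus_X_powr (of_real \<alpha>) - fps_const (of_real lam)) * ?S) $ n =
          of_real (((one_minus_X_powr \<alpha> - fps_const lam) * ml_fps \<alpha> \<beta> lam) $ n)"
      by (simp only: fps_mult_nth 1 fps_nth_Abs_fps of_real_sum of_real_mult)
    also have "\<dots> = one_minus_X_powr (of_real (\<alpha> - \<beta>)) $ n"
      by (simp only: ml_fps_mult[OF assms] one_minus_X_powr_of_real)
    finally show "((one_minus_X_powr (of_real \<alpha>) - fps_const (of_real lam)) * ?S) $ n =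
                  one_minus_X_powr (of_real \<alpha> - of_real \<beta>) $ n" by simp
  qed
  then have "?S = ml_fps (of_real \<alpha>) (of_real \<beta>) (of_real lam)"
    using assms by (intro ml_fps_unique) simp_all
  then show ?thesis
    by (metis fps_nth_Abs_fps)
qed

text \<open>
  The coefficients of the inverse satisfy a recursion in which the only division is by the
  constant term \<open>1 - z\<close>, so no singularity other than \<open>z = 1\<close> can arise.
\<close>

lemma holomorphic_on_ml_fps_nth:
  "(\<lambda>z. ml_fps \<alpha> \<beta> z $ m) holomorphic_on (- {1})"
proof -
  have inv: "(\<lambda>z. inverse (one_minus_X_powr \<alpha> - fps_const z) $ i) holomorphic_on (- {1})" for i
  proof (induction i rule: less_induct)
    case (less i)
    show ?case
    proof (cases i)
      case 0
      then show ?thesis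
        by (auto intro!: holomorphic_intros)
    next
      case (Suc k)
      have "inverse (one_minus_X_powr \<alpha> - fps_const z) $ i =
        - inverse (1 - z) * (\<Sum>l=1..i. one_minus_X_powr \<alpha> $ l *
             inverse (one_minus_X_powr \<alpha> - fps_const z) $ (i - l))" if "z \<in> - {1}" for z
      proof -
        have "(one_minus_X_powr \<alpha> - fps_const z) * inverse (one_minus_X_powr \<alpha> - fps_const z) = 1"
          using that by (subst mult.commute, intro inverse_mult_eq_1) simp
        then have "((one_minus_X_powr \<alpha> - fps_const z) *
                    inverse (one_minus_X_powr \<alpha> - fps_const z)) $ i = 0"
          using Suc by simp
        then have "(1 - z) * inverse (one_minus_X_powr \<alpha> - fps_const z) $ i +
           (\<Sum>l=1..i. one_minus_X_powr \<alpha> $ l *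
             inverse (one_minus_X_powr \<alpha> - fps_const z) $ (i - l)) = 0"
          by (simp add: fps_mult_nth sum.atLeast_Suc_atMost)
        then show ?thesis
          using that by (simp add: field_simps eq_neg_iff_add_eq_0)
      qed
      moreover have "(\<lambda>z. - inverse (1 - z) * (\<Sum>l=1..i. one_minus_X_powr \<alpha> $ l *
             inverse (one_minus_X_powr \<alpha> - fps_const z) $ (i - l))) holomorphic_on (- {1})"
        using less.IH by (intro holomorphic_intros) auto
      ultimately show ?thesis
        by (elim holomorphic_transform) simp
    qed
  qed
  show ?thesis
    unfolding ml_fps_def fps_mult_nth by (intro holomorphic_intros inv)
qed

section \<open>Convergence of the Mittag-Leffler series\<close>

text \<open>
  The coefficient of \<open>z\<^sup>j\<close> is a polynomial in \<open>j\<close>. Raising \<open>m\<close> by one multiplies it by a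
  linear factor in \<open>j\<close>, and a factor \<open>j\<close> amounts to applying \<open>z * d/dz\<close>, which preserves
  convergence in the unit disc.
\<close>

lemma summable_one_minus_X_powr:
  fixes z :: complex
  assumes "norm z < 1"
  shows "summable (\<lambda>j. one_minus_X_powr (- (of_nat j * \<alpha> + \<beta>)) $ m * z ^ j)"
  using assms
proof (induction m arbitrary: z)
  case 0
  then show ?case by (simp add: summable_geometric)
next
  case (Suc m)
  define c where "c j = one_minus_X_powr (- (of_nat j * \<alpha> + \<beta>)) $ m" for j
  have "summable (\<lambda>j. z * (diffs c j * z ^ j))"
    using Suc by (intro summable_mult termdiff_converges[where K = 1]) (simp_all add: c_def)
  then have "summable (\<lambda>j. of_nat (Suc j) * c (Suc j) * z ^ Suc j)"
    by (simp add: diffs_def mult_ac)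
  then have "summable (\<lambda>j. of_nat j * c j * z ^ j)"
    by (subst (asm) summable_Suc_iff)
  moreover have "summable (\<lambda>j. c j * z ^ j)"
    using Suc by (simp add: c_def)
  (* The new linear factor (j \<alpha> + \<beta> + m) / (m + 1) of the Pochhammer quotient, split into
     its multiple of j and its constant part. *)
  ultimately have "summable (\<lambda>j. \<alpha> / of_nat (Suc m) * (of_nat j * c j * z ^ j) +
      (\<beta> + of_nat m) / of_nat (Suc m) * (c j * z ^ j))"
    by (intro summable_add summable_mult)
  also have "(\<lambda>j. \<alpha> / of_nat (Suc m) * (of_nat j * c j * z ^ j) +
      (\<beta> + of_nat m) / of_nat (Suc m) * (c j * z ^ j)) =
      (\<lambda>j. one_minus_X_powr (- (of_nat j * \<alpha> + \<beta>)) $ Suc m * z ^ j)"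
    by (rule ext) (simp add: c_def one_minus_X_powr_nth_pochhammer pochhammer_Suc divide_simps,
        simp add: algebra_simps)
  finally show ?case .
qed

text \<open>
  Multiplying the \<open>j\<close>-th series \<open>P j = (1 - X) powr (- (j * \<alpha> + \<beta>))\<close> by \<open>(1 - X) powr \<alpha>\<close>
  lowers \<open>j\<close> by one. So the product of \<open>(1 - X) powr \<alpha> - z\<close> and \<open>\<Sum>\<^sub>j z\<^sup>j * P j\<close> telescopes to
  \<open>(1 - X) powr (\<alpha> - \<beta>)\<close>, which characterises the quotient.
\<close>

lemma sums_ml_fps_nth:
  fixes z :: complex
  assumes z: "norm z < 1"
  shows "(\<lambda>j. one_minus_X_powr (- (of_nat j * \<alpha> + \<beta>)) $ m * z ^ j) sums (ml_fps \<alpha> \<beta> z $ m)"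
proof -
  define P where "P j = one_minus_X_powr (- (of_nat j * \<alpha> + \<beta>))" for j
  define S where "S = Abs_fps (\<lambda>m. \<Sum>j. P j $ m * z ^ j)"
  have sums: "(\<lambda>j. P j $ m * z ^ j) sums (S $ m)" for m
    using summable_one_minus_X_powr[OF z, of \<alpha> \<beta> m] by (simp add: S_def P_def summable_sums)
  have step: "one_minus_X_powr \<alpha> * P (Suc j) = P j" for j
    by (simp add: P_def algebra_simps flip: one_minus_X_powr_add)
  have "(one_minus_X_powr \<alpha> - fps_const z) * S = one_minus_X_powr (\<alpha> - \<beta>)"
  proof (rule fps_ext)
    fix m
    have "(\<lambda>j. \<Sum>i=0..m. one_minus_X_powr \<alpha> $ i * (P j $ (m - i) * z ^ j)) sums
          (\<Sum>i=0..m. one_minus_X_powr \<alpha> $ i * S $ (m - i))"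
      by (intro sums_sum sums_mult sums)
    moreover have "(\<Sum>i=0..m. one_minus_X_powr \<alpha> $ i * (P j $ (m - i) * z ^ j)) =
      (one_minus_X_powr \<alpha> * P j) $ m * z ^ j" for j
      by (simp add: fps_mult_nth sum_distrib_right mult.assoc)
    ultimately have "(\<lambda>j. (one_minus_X_powr \<alpha> * P j) $ m * z ^ j) sums
          ((one_minus_X_powr \<alpha> * S) $ m)"
      by (simp add: fps_mult_nth)
    (* Splitting off j = 0 leaves z times the original series. *)
    then have "(\<lambda>j. (one_minus_X_powr \<alpha> * P (Suc j)) $ m * z ^ Suc j) sums
          ((one_minus_X_powr \<alpha> * S) $ m - (one_minus_X_powr \<alpha> * P 0) $ m)"
      by (subst sums_Suc_iff) simp
    then have "(\<lambda>j. z * (P j $ m * z ^ j)) sums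
          ((one_minus_X_powr \<alpha> * S) $ m - (one_minus_X_powr \<alpha> * P 0) $ m)"
      by (simp add: step mult_ac)
    moreover have "(\<lambda>j. z * (P j $ m * z ^ j)) sums (z * S $ m)"
      by (intro sums_mult sums)
    ultimately have "(one_minus_X_powr \<alpha> * S) $ m - (one_minus_X_powr \<alpha> * P 0) $ m = z * S $ m"
      by (rule sums_unique2)
    moreover have "one_minus_X_powr \<alpha> * P 0 = one_minus_X_powr (\<alpha> - \<beta>)"
      by (simp add: P_def flip: one_minus_X_powr_add)
    ultimately show "((one_minus_X_powr \<alpha> - fps_const z) * S) $ m = one_minus_X_powr (\<alpha> - \<beta>) $ m"
      by (simp add: algebra_simps)
  qed
  then have "S = ml_fps \<alpha> \<beta> z"
    using z by (intro ml_fps_unique) auto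
  then show ?thesis
    using sums[of m] by (simp add: P_def)
qed

text \<open>
  Positivity of \<open>j * \<alpha> + \<beta>\<close> keeps both Gamma values in \<open>ml_coeff\<close> away from the poles, where
  their quotient is a Pochhammer symbol.
\<close>

lemma ml_coeff_eq_nth:
  assumes "0 \<le> \<alpha>" "0 < \<beta>"
  shows "ml_coeff \<alpha> \<beta> (a + 1 + real m) a j = one_minus_X_powr (- (real j * \<alpha> + \<beta>)) $ m"
proof -
  have pos: "0 < real j * \<alpha> + \<beta>"
    using assms by (simp add: add_nonneg_pos)
  then have "real j * \<alpha> + \<beta> \<notin> \<int>\<^sub>\<le>\<^sub>0"
    by (auto elim!: nonpos_Ints_cases)
  then have "pochhammer (real j * \<alpha> + \<beta>) m = 
      Gamma (real j * \<alpha> + \<beta> + real m) / Gamma (real j * \<alpha> + \<beta>)"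
    by (rule pochhammer_Gamma)
  then show ?thesis
    by (simp add: ml_coeff_def rising_def one_minus_X_powr_nth_pochhammer Gamma_fact add_ac)
qed

text \<open>
  The coefficients are bounded below by their value at \<open>j = 0\<close>, which is positive, so for
  \<open>\<bar>lam\<bar> \<ge> 1\<close> the terms do not tend to zero. Hence it is the continuation branch of \<open>disc_ml\<close>
  that applies there.
\<close>

lemma not_summable_ml_series:
  assumes "0 \<le> \<alpha>" "0 < \<beta>" "1 \<le> \<bar>lam\<bar>"
  shows "\<not> summable (\<lambda>j. one_minus_X_powr (- (real j * \<alpha> + \<beta>)) $ m * lam ^ j)"
proof
  assume "summable (\<lambda>j. one_minus_X_powr (- (real j * \<alpha> + \<beta>)) $ m * lam ^ j)"
  then have "(\<lambda>j. \<bar>one_minus_X_powr (- (real j * \<alpha> + \<beta>)) $ m * lam ^ j\<bar>) \<longlonglongrightarrow> 0"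
    by (intro tendsto_rabs_zero summable_LIMSEQ_zero)
  moreover have "pochhammer \<beta> m / fact m \<le> \<bar>one_minus_X_powr (- (real j * \<alpha> + \<beta>)) $ m * lam ^ j\<bar>"
    for j
  proof -
    have "pochhammer \<beta> m \<le> pochhammer (real j * \<alpha> + \<beta>) m"
      unfolding pochhammer_prod using assms by (intro prod_mono) auto
    moreover have "0 < pochhammer \<beta> m"
      using assms by (intro pochhammer_pos)
    moreover have "1 \<le> \<bar>lam ^ j\<bar>"
      using assms by (simp add: power_abs)
    ultimately have "pochhammer \<beta> m * 1 \<le> pochhammer (real j * \<alpha> + \<beta>) m * \<bar>lam ^ j\<bar>"
      by (intro mult_mono) auto
    then show ?thesis
      using \<open>0 < pochhammer \<beta> m\<close> \<open>pochhammer \<beta> m \<le> pochhammer (real j * \<alpha> + \<beta>) m\<close>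
      by (simp add: one_minus_X_powr_nth_pochhammer abs_mult divide_simps add.commute[of \<beta>])
  qed
  ultimately have "pochhammer \<beta> m / fact m \<le> 0"
    by (intro LIMSEQ_le_const) auto
  moreover have "0 < pochhammer \<beta> m / fact m"
    using assms by (intro divide_pos_pos pochhammer_pos) auto
  ultimately show False by simp
qed

text \<open>
  For \<open>\<bar>lam\<bar> < 1\<close> this is the geometric series. Otherwise the coefficient of the complex
  quotient, as a function of \<open>z\<close>, is one admissible continuation \<open>g\<close>. Any other agrees
  with it on the unit disc, hence on the whole connected set \<open>- {1}\<close>, so the value at \<open>lam\<close>
  is determined.
\<close>

lemma disc_ml_eq_ml_fps_nth:
  assumes "0 \<le> \<alpha>" "0 < \<beta>" "lam \<noteq> 1"
  shows "disc_ml \<alpha> \<beta> lam (a + 1 + real m) a = ml_fps \<alpha> \<beta> lam $ m"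
proof -
  define c where "c j = one_minus_X_powr (- (real j * \<alpha> + \<beta>)) $ m" for j
  let ?k = "a + 1 + real m"
  let ?\<alpha> = "complex_of_real \<alpha>" and ?\<beta> = "complex_of_real \<beta>"
  let ?G = "\<lambda>z. ml_fps ?\<alpha> ?\<beta> z $ m"
  have c: "ml_coeff \<alpha> \<beta> ?k a j = c j" for j
    using assms by (simp add: ml_coeff_eq_nth c_def)
  have series: "(\<lambda>j. lam ^ j / Gamma (real j * \<alpha> + \<beta>) * rising (?k - a) (real j * \<alpha> + \<beta> - 1)) =
    (\<lambda>j. c j * lam ^ j)"
    by (rule ext) (simp add: c[symmetric] ml_coeff_def)
  have cc: "complex_of_real (c j) = one_minus_X_powr (- (of_nat j * ?\<alpha> + ?\<beta>)) $ m" for j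
    by (simp add: c_def flip: one_minus_X_powr_of_real)
  have sumsG: "(\<lambda>j. complex_of_real (c j) * z ^ j) sums ?G z" if "norm z < 1" for z
    unfolding cc by (rule sums_ml_fps_nth[OF that])
  show ?thesis
  proof (cases "\<bar>lam\<bar> < 1")
    case True
    have "(\<lambda>j. complex_of_real (c j * lam ^ j)) sums of_real (ml_fps \<alpha> \<beta> lam $ m)"
      using sumsG[of "of_real lam"] True by (simp add: ml_fps_of_real[OF assms(3)])
    then have "(\<lambda>j. c j * lam ^ j) sums (ml_fps \<alpha> \<beta> lam $ m)"
      by (simp only: sums_of_real_iff)
    then show ?thesis
      unfolding disc_ml_def series by (simp add: sums_iff)
  next
    case False
    then have ns: "\<not> summable (\<lambda>j. c j * lam ^ j)"
      unfolding c_def using assms by (intro not_summable_ml_series) auto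
    have "(THE w. \<exists>g. g holomorphic_on (- {1}) \<and>
              (\<forall>z\<in>ball 0 1. (\<lambda>j. complex_of_real (c j) * z ^ j) sums g z) \<and>
              g (complex_of_real lam) = complex_of_real w) = ml_fps \<alpha> \<beta> lam $ m"
    proof (rule the_equality)
      show "\<exists>g. g holomorphic_on (- {1}) \<and>
              (\<forall>z\<in>ball 0 1. (\<lambda>j. complex_of_real (c j) * z ^ j) sums g z) \<and>
              g (complex_of_real lam) = complex_of_real (ml_fps \<alpha> \<beta> lam $ m)"
        using holomorphic_on_ml_fps_nth sumsG ml_fps_of_real[OF assms(3)]
        by (intro exI[of _ ?G]) auto
    next
      fix w
      assume "\<exists>g. g holomorphic_on (- {1}) \<and>
              (\<forall>z\<in>ball 0 1. (\<lambda>j. complex_of_real (c j) * z ^ j) sums g z) \<and>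
              g (complex_of_real lam) = complex_of_real w"
      then obtain g where g: "g holomorphic_on (- {1})"
        "\<And>z. z \<in> ball 0 1 \<Longrightarrow> (\<lambda>j. complex_of_real (c j) * z ^ j) sums g z"
        "g (of_real lam) = of_real w"
        by blast
      have "g (of_real lam) = ?G (of_real lam)"
      proof (rule analytic_continuation_open[of "ball 0 1" "- {1}" g ?G])
        show "connected (- {1::complex})"
          by (intro connected_punctured_universe) simp
        show "g z = ?G z" if "z \<in> ball 0 1" for z
          using g(2)[OF that] sumsG[of z] that by (simp add: sums_unique2)
      qed (use assms g(1) holomorphic_on_ml_fps_nth in auto)
      then show "w = ml_fps \<alpha> \<beta> lam $ m"
        using g(3) by (simp add: ml_fps_of_real[OF assms(3)])
    qed
    then show ?thesis
      unfolding disc_ml_def series c using ns by simp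
  qed
qed

section \<open>Generating functions of signals\<close>

definition signal_fps :: "real \<Rightarrow> (real \<Rightarrow> real) \<Rightarrow> real fps" where
  "signal_fps a f = Abs_fps (\<lambda>m. f (a + 1 + real m))"

lemma nabla_diff_0: "nabla_diff 0 f = f"
  by (simp add: nabla_diff_def fun_eq_iff)

lemma nabla_diff_Suc: "nabla_diff (Suc n) f k = nabla_diff n f k - nabla_diff n f (k - 1)"
proof -
  let ?t = "\<lambda>N j. (-1) ^ j * real (N choose j) * f (k - real j)"
  have "nabla_diff (Suc n) f k = f k + (\<Sum>j\<le>n. ?t (Suc n) (Suc j))"
    by (simp add: nabla_diff_def atLeast0AtMost sum.atMost_Suc_shift del: sum.atMost_Suc)
  also have "(\<Sum>j\<le>n. ?t (Suc n) (Suc j)) =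
      (\<Sum>j\<le>n. ?t n (Suc j)) - (\<Sum>j\<le>n. (-1) ^ j * real (n choose j) * f (k - 1 - real j))"
    unfolding sum_subtractf[symmetric] by (rule sum.cong) (simp_all add: algebra_simps)
  also have "f k + ((\<Sum>j\<le>n. ?t n (Suc j)) -
        (\<Sum>j\<le>n. (-1) ^ j * real (n choose j) * f (k - 1 - real j))) =
      (\<Sum>j\<le>Suc n. ?t n j) - nabla_diff n f (k - 1)"
    by (simp add: nabla_diff_def atLeast0AtMost sum.atMost_Suc_shift del: sum.atMost_Suc)
  also have "(\<Sum>j\<le>Suc n. ?t n j) = nabla_diff n f k"
    by (simp add: nabla_diff_def atLeast0AtMost)
  finally show ?thesis .
qed

text \<open>
  Each application of \<open>\<nabla>\<close> multiplies by \<open>1 - X\<close> and subtracts the value at \<open>a\<close>, because the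
  first entry of the sequence, at \<open>a + 1\<close>, refers back to the point \<open>a\<close> outside of it. The
  value split off in step \<open>\<kappa>\<close> is multiplied by the remaining \<open>n - 1 - \<kappa>\<close> factors.
\<close>

lemma signal_fps_nabla_diff:
  "signal_fps a (nabla_diff n f) = one_minus_X_powr (real n) * signal_fps a f -
     (\<Sum>\<kappa><n. fps_const (nabla_diff \<kappa> f a) * one_minus_X_powr (real n - 1 - real \<kappa>))"
proof (induction n)
  case 0
  then show ?case by (simp add: nabla_diff_0 one_minus_X_powr_0)
next
  case (Suc n)
  have "signal_fps a (nabla_diff (Suc n) f) =
      (1 - fps_X) * signal_fps a (nabla_diff n f) - fps_const (nabla_diff n f a)"
  proof (rule fps_ext)
    fix m
    show "signal_fps a (nabla_diff (Suc n) f) $ m =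
      ((1 - fps_X) * signal_fps a (nabla_diff n f) - fps_const (nabla_diff n f a)) $ m"
      by (cases m) (simp_all add: signal_fps_def nabla_diff_Suc algebra_simps)
  qed
  also have "\<dots> = one_minus_X_powr 1 * one_minus_X_powr (real n) * signal_fps a f -
     (\<Sum>\<kappa><n. fps_const (nabla_diff \<kappa> f a) *
         (one_minus_X_powr 1 * one_minus_X_powr (real n - 1 - real \<kappa>))) -
      fps_const (nabla_diff n f a)"
    by (simp add: Suc.IH one_minus_X_powr_1 right_diff_distrib sum_distrib_left mult_ac)
  also have "\<dots> = one_minus_X_powr (real (Suc n)) * signal_fps a f -
     (\<Sum>\<kappa><Suc n. fps_const (nabla_diff \<kappa> f a) * one_minus_X_powr (real (Suc n) - 1 - real \<kappa>))"
    by (simp add: one_minus_X_powr_0 flip: one_minus_X_powr_add)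
  finally show ?case .
qed

lemma signal_fps_nabla_frac_sum:
  "signal_fps a (nabla_frac_sum a \<gamma> f) = one_minus_X_powr (- \<gamma>) * signal_fps a f"
proof (rule fps_ext)
  fix m
  have "{j. real j \<le> a + 1 + real m - a - 1} = {0..m}"
    by auto
  then show "signal_fps a (nabla_frac_sum a \<gamma> f) $ m =
      (one_minus_X_powr (- \<gamma>) * signal_fps a f) $ m"
    unfolding fps_mult_nth
    by (auto simp: signal_fps_def nabla_frac_sum_def one_minus_X_powr_def
        of_nat_diff algebra_simps intro!: sum.cong)
qed

lemma signal_fps_nabla_caputo:
  "signal_fps a (nabla_caputo n \<alpha> a y) = one_minus_X_powr \<alpha> * signal_fps a y -
     (\<Sum>\<kappa><n. fps_const (nabla_diff \<kappa> y a) * one_minus_X_powr (\<alpha> - (real \<kappa> + 1)))"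
proof -
  have "signal_fps a (nabla_caputo n \<alpha> a y) =
      one_minus_X_powr (\<alpha> - real n) * signal_fps a (nabla_diff n y)"
    using signal_fps_nabla_frac_sum[of a "real n - \<alpha>" "nabla_diff n y"]
    by (simp add: nabla_caputo_def[abs_def])
  also have "\<dots> = one_minus_X_powr (\<alpha> - real n) * one_minus_X_powr (real n) * signal_fps a y -
     (\<Sum>\<kappa><n. fps_const (nabla_diff \<kappa> y a) *
       (one_minus_X_powr (\<alpha> - real n) * one_minus_X_powr (real n - 1 - real \<kappa>)))"
    by (simp add: signal_fps_nabla_diff right_diff_distrib sum_distrib_left mult_ac)
  also have "\<dots> = one_minus_X_powr \<alpha> * signal_fps a y -
     (\<Sum>\<kappa><n. fps_const (nabla_diff \<kappa> y a) * one_minus_X_powr (\<alpha> - (real \<kappa> + 1)))"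
    by (simp add: algebra_simps flip: one_minus_X_powr_add)
  finally show ?thesis .
qed

section \<open>Solving the system\<close>

text \<open>
  Once the initial conditions have replaced the boundary values of \<open>y\<close> by \<open>b\<close>, the system
  equation is linear in the generating function of \<open>y\<close>, and dividing by
  \<open>(1 - X) powr \<alpha> - lam\<close> turns each term on the right-hand side into a Mittag-Leffler
  generating function.
\<close>

lemma time_response_iff_signal_fps:
  assumes "lam \<noteq> 1"
  shows "time_response n \<alpha> a lam u b y \<longleftrightarrow>
    (\<forall>\<kappa><n. nabla_diff \<kappa> y a = b \<kappa>) \<and>
    signal_fps a y = ml_fps \<alpha> \<alpha> lam * signal_fps a u +
      (\<Sum>\<kappa><n. fps_const (b \<kappa>) * ml_fps \<alpha> (real \<kappa> + 1) lam)" (is "_ \<longleftrightarrow> ?ic \<and> ?Y = ?R")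
proof -
  define D where "D = one_minus_X_powr \<alpha> - fps_const lam"
  have "D $ 0 \<noteq> 0"
    using assms by (simp add: D_def)
  then have "D \<noteq> 0"
    by (metis fps_zero_nth)
  have D: "D * ml_fps \<alpha> \<beta> lam = one_minus_X_powr (\<alpha> - \<beta>)" for \<beta>
    unfolding D_def by (rule ml_fps_mult[OF assms])
  have "(\<forall>k \<in> nset (a + 1). nabla_caputo n \<alpha> a y k = lam * y k + u k) \<longleftrightarrow> ?Y = ?R"
    if ic: ?ic
  proof -
    have "(\<forall>k \<in> nset (a + 1). nabla_caputo n \<alpha> a y k = lam * y k + u k) \<longleftrightarrow>
      signal_fps a (nabla_caputo n \<alpha> a y) = fps_const lam * ?Y + signal_fps a u"
      by (auto simp: nset_def signal_fps_def fps_eq_iff)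
    also have "\<dots> \<longleftrightarrow> D * ?Y = signal_fps a u +
      (\<Sum>\<kappa><n. fps_const (b \<kappa>) * one_minus_X_powr (\<alpha> - (real \<kappa> + 1)))"
      using ic by (auto simp: signal_fps_nabla_caputo D_def algebra_simps)
    also have "signal_fps a u +
      (\<Sum>\<kappa><n. fps_const (b \<kappa>) * one_minus_X_powr (\<alpha> - (real \<kappa> + 1))) =
      (D * ml_fps \<alpha> \<alpha> lam) * signal_fps a u +
      (\<Sum>\<kappa><n. fps_const (b \<kappa>) * (D * ml_fps \<alpha> (real \<kappa> + 1) lam))"
      by (simp add: D one_minus_X_powr_0)
    also have "\<dots> = D * ?R"
      by (simp add: distrib_left sum_distrib_left mult_ac)
    also have "D * ?Y = D * ?R \<longleftrightarrow> ?Y = ?R"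
      using \<open>D \<noteq> 0\<close> by simp
    finally show ?thesis .
  qed
  then show ?thesis
    unfolding time_response_def by blast
qed

text \<open>
  The coefficient \<open>\<plusminus>1\<close> of the oldest value makes the initial conditions uniquely solvable, one
  value at a time.
\<close>

lemma nabla_diff_top_term:
  "nabla_diff N y a = (\<Sum>j<N. (-1) ^ j * real (N choose j) * y (a - real j)) + (-1) ^ N * y (a - real N)"
  by (simp add: nabla_diff_def atLeast0AtMost flip: lessThan_Suc_atMost)

text \<open>
  Backward differences of order below \<open>N\<close> do not see the point \<open>a - N\<close>, so the value there can
  be adjusted to give the difference of order \<open>N\<close> the required value without spoiling the
  conditions already met or the values after \<open>a\<close>.
\<close>

lemma ex_initial_values:
  "\<exists>y. (\<forall>\<kappa><N. nabla_diff \<kappa> y a = b \<kappa>) \<and> (\<forall>m. y (a + 1 + real m) = f m)"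
proof (induction N)
  case 0
  have "\<exists>y. \<forall>m. y (a + 1 + real m) = f m"
    by (rule exI[of _ "\<lambda>k. f (nat \<lfloor>k - a - 1\<rfloor>)"]) simp
  then show ?case by simp
next
  case (Suc N)
  then obtain y where y: "\<And>\<kappa>. \<kappa> < N \<Longrightarrow> nabla_diff \<kappa> y a = b \<kappa>" "\<And>m. y (a + 1 + real m) = f m"
    by blast
  define s where "s = (\<Sum>j<N. (-1) ^ j * real (N choose j) * y (a - real j))"
  define y' where "y' = y(a - real N := (-1) ^ N * (b N - s))"
  have "nabla_diff \<kappa> y' a = nabla_diff \<kappa> y a" if "\<kappa> < N" for \<kappa>
    using that by (auto simp: nabla_diff_def y'_def intro!: sum.cong)
  moreover have "nabla_diff N y' a = b N"
  proof -
    have "(\<Sum>j<N. (-1) ^ j * real (N choose j) * y' (a - real j)) = s"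
      by (auto simp: s_def y'_def intro!: sum.cong)
    then show ?thesis
      by (simp add: nabla_diff_top_term y'_def flip: mult.assoc power_mult_distrib)
  qed
  moreover have "y' (a + 1 + real m) = f m" for m
    using y(2) by (simp add: y'_def)
  ultimately show ?case
    using y(1) by (intro exI[of _ y']) (auto simp: less_Suc_eq)
qed

lemma initial_values_unique:
  assumes "\<And>\<kappa>. \<kappa> < n \<Longrightarrow> nabla_diff \<kappa> y a = nabla_diff \<kappa> y' a" and "N < n"
  shows "y (a - real N) = y' (a - real N)"
  using \<open>N < n\<close>
proof (induction N rule: less_induct)
  case (less N)
  then have "(\<Sum>j<N. (-1) ^ j * real (N choose j) * y (a - real j)) =
      (\<Sum>j<N. (-1) ^ j * real (N choose j) * y' (a - real j))"
    by (intro sum.cong) auto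
  then show ?case
    using assms(1)[OF less.prems] by (simp add: nabla_diff_top_term)
qed

theorem theorem4:
  fixes n :: nat and \<alpha> a lam :: real and u :: "real \<Rightarrow> real" and b :: "nat \<Rightarrow> real"
  assumes "n \<ge> 1" and "real n - 1 < \<alpha>" and "\<alpha> < real n" and "lam \<noteq> 1"
  shows "(\<exists>y. time_response n \<alpha> a lam u b y) \<and>
    (\<forall>y y'. time_response n \<alpha> a lam u b y \<longrightarrow> time_response n \<alpha> a lam u b y' \<longrightarrow>
       (\<forall>k \<in> nset (a - real n + 1). y k = y' k)) \<and>
    (\<forall>y. time_response n \<alpha> a lam u b y \<longrightarrow>
       (\<forall>k \<in> nset (a + 1).
          y k = (\<Sum>\<kappa><n. b \<kappa> * disc_ml \<alpha> (real \<kappa> + 1) lam k a)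
              + (\<Sum>\<tau> | \<tau> \<in> nset (a + 1) \<and> \<tau> \<le> k.
                   disc_ml \<alpha> \<alpha> lam \<tau> a * u (k - \<tau> + a + 1))))"
proof (intro conjI allI impI ballI)
  have "0 < \<alpha>"
    using assms by linarith
  note iff = time_response_iff_signal_fps[OF \<open>lam \<noteq> 1\<close>, of n \<alpha> a u b]
  define R where "R = ml_fps \<alpha> \<alpha> lam * signal_fps a u +
      (\<Sum>\<kappa><n. fps_const (b \<kappa>) * ml_fps \<alpha> (real \<kappa> + 1) lam)"
  have response_nth: "y (a + 1 + real m) = R $ m" if "time_response n \<alpha> a lam u b y" for y m
  proof -
    have "signal_fps a y $ m = R $ m"
      using that by (simp add: iff R_def)
    then show ?thesis
      by (simp add: signal_fps_def)
  qed
  show "\<exists>y. time_response n \<alpha> a lam u b y"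
  proof -
    obtain y where "\<forall>\<kappa><n. nabla_diff \<kappa> y a = b \<kappa>" "\<forall>m. y (a + 1 + real m) = R $ m"
      using ex_initial_values[of n a b "\<lambda>m. R $ m"] by blast
    then have "time_response n \<alpha> a lam u b y"
      unfolding iff R_def[symmetric] by (simp add: signal_fps_def fps_eq_iff)
    then show ?thesis
      by blast
  qed
  show "y k = y' k" if y: "time_response n \<alpha> a lam u b y" and y': "time_response n \<alpha> a lam u b y'"
    and k: "k \<in> nset (a - real n + 1)" for y y' k
  proof -
    obtain j where j: "k = a - real n + 1 + real j"
      using k by (auto simp: nset_def)
    show ?thesis
    proof (cases "j < n")
      case True
      then have "k = a - real (n - 1 - j)"
        using j by (simp add: of_nat_diff)
      then show ?thesis
        using initial_values_unique[of n y a y' "n - 1 - j"] y y' \<open>n \<ge> 1\<close>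
        by (simp add: time_response_def)
    next
      case False
      then have "k = a + 1 + real (j - n)"
        using j by (simp add: of_nat_diff)
      then show ?thesis
        using response_nth[OF y] response_nth[OF y'] by simp
    qed
  qed
  show "y k = (\<Sum>\<kappa><n. b \<kappa> * disc_ml \<alpha> (real \<kappa> + 1) lam k a)
              + (\<Sum>\<tau> | \<tau> \<in> nset (a + 1) \<and> \<tau> \<le> k. disc_ml \<alpha> \<alpha> lam \<tau> a * u (k - \<tau> + a + 1))"
    if y: "time_response n \<alpha> a lam u b y" and k: "k \<in> nset (a + 1)" for y k
  proof -
    obtain m where m: "k = a + 1 + real m"
      using k by (auto simp: nset_def)
    have ml: "disc_ml \<alpha> \<beta> lam (a + 1 + real i) a = ml_fps \<alpha> \<beta> lam $ i" if "0 < \<beta>" for \<beta> i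
      using that \<open>0 < \<alpha>\<close> \<open>lam \<noteq> 1\<close> by (simp add: disc_ml_eq_ml_fps_nth)
    have img: "{\<tau>. \<tau> \<in> nset (a + 1) \<and> \<tau> \<le> k} = (\<lambda>i. a + 1 + real i) ` {0..m}"
      by (auto simp: m nset_def)
    have "(\<Sum>\<tau> | \<tau> \<in> nset (a + 1) \<and> \<tau> \<le> k. disc_ml \<alpha> \<alpha> lam \<tau> a * u (k - \<tau> + a + 1)) =
        (\<Sum>i=0..m. ml_fps \<alpha> \<alpha> lam $ i * signal_fps a u $ (m - i))"
      unfolding img
    proof (subst sum.reindex, simp add: inj_on_def, rule sum.cong)
      fix i assume "i \<in> {0..m}"
      then have "k - (a + 1 + real i) + a + 1 = a + 1 + real (m - i)"
        by (simp add: m of_nat_diff)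
      then show "((\<lambda>\<tau>. disc_ml \<alpha> \<alpha> lam \<tau> a * u (k - \<tau> + a + 1)) \<circ> (\<lambda>i. a + 1 + real i)) i =
          ml_fps \<alpha> \<alpha> lam $ i * signal_fps a u $ (m - i)"
        using \<open>0 < \<alpha>\<close> by (simp add: ml signal_fps_def)
    qed simp
    also have "\<dots> = (ml_fps \<alpha> \<alpha> lam * signal_fps a u) $ m"
      by (simp add: fps_mult_nth)
    finally show ?thesis
      using response_nth[OF y, of m] by (simp add: m ml R_def fps_sum_nth)
  qed
qed

end
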